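(* Let $f$ be a fixed nonnegative integer. For every $n$-vertex undirected unweighted graph $G=(V,E)$ and every set of source vertices $S\subseteq V$, there is an $(f+1)$-FT $S\times S$ distance preserver of $G$ with $O\left(n^{2-1/2^f}|S|^{1/2^f}\right)$ edges.
   Context: For $S,T\subseteq V$ and an integer $k\ge 0$, a subgraph $H\subseteq G$ is a $k$-FT $S\times T$ distance preserver if $\mathrm{dist}_{H\setminus F}(s,t)=\mathrm{dist}_{G\setminus F}(s,t)$ for every $s\in S$, $t\in T$ and every edge set $F\subseteq E$ with $|F|\le k$. The constant in the $O(\cdot)$ may depend on $f$. *)

theory Defs
  imports "Graph_Theory.Graph_Theory" Complex_Main
begin

text \<open>
  A finite simple undirected graph is a \<open>pair_graph\<close>, in which every undirected edge is
  represented by two opposite arcs. Edges are counted, and deleted, as two-element vertex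
  sets, so that deleting an edge deletes both of its arcs.
\<close>

definition uedges :: "'a pair_pre_digraph \<Rightarrow> 'a set set" where
  "uedges G = {{u, v} | u v. (u, v) \<in> parcs G}"

definition del_uedges :: "'a pair_pre_digraph \<Rightarrow> 'a set set \<Rightarrow> 'a pair_pre_digraph" where
  "del_uedges G F =
     \<lparr> pverts = pverts G, parcs = {(u, v). (u, v) \<in> parcs G \<and> {u, v} \<notin> F} \<rparr>"

text \<open>The distance is \<open>\<infinity>\<close> if no walk in the graph joins the two vertices.\<close>

definition gdist :: "'a pair_pre_digraph \<Rightarrow> 'a \<Rightarrow> 'a \<Rightarrow> ereal" where
  "gdist G s t = wf_digraph.\<mu> (with_proj G) (\<lambda>_. 1) s t"

definition ft_dist_preserver ::
  "nat \<Rightarrow> 'a set \<Rightarrow> 'a set \<Rightarrow> 'a pair_pre_digraph \<Rightarrow> 'a pair_pre_digraph \<Rightarrow> bool" where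
  "ft_dist_preserver k S T G H \<longleftrightarrow>
     pair_graph H \<and> subgraph (with_proj H) (with_proj G) \<and>
     (\<forall>s \<in> S. \<forall>t \<in> T. \<forall>F. F \<subseteq> uedges G \<and> card F \<le> k \<longrightarrow>
        gdist (del_uedges H F) s t = gdist (del_uedges G F) s t)"

lemma pair_graph_del_uedges:
  assumes "pair_graph G"
  shows "pair_graph (del_uedges G F)"
proof -
  interpret pair_graph G by fact
  have sub: "parcs (del_uedges G F) \<subseteq> parcs G" and v: "pverts (del_uedges G F) = pverts G"
    by (auto simp: del_uedges_def)
  have "sym (parcs G)"
    using sym_arcs by (simp add: symmetric_def)
  then have "sym (parcs (del_uedges G F))"
    by (auto simp: del_uedges_def sym_def insert_commute)
  moreover have "arcs_ends (with_proj (del_uedges G F)) = parcs (del_uedges G F)"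
    by (auto simp: arcs_ends_conv)
  ultimately have s: "symmetric (with_proj (del_uedges G F))"
    by (simp add: symmetric_def)
  have wf: "fst e \<in> pverts G" "snd e \<in> pverts G" "fst e \<noteq> snd e"
    if "e \<in> parcs (del_uedges G F)" for e
    using that sub arc_fst_in_verts arc_snd_in_verts pair_no_loops by blast+
  show ?thesis
    using v s wf pair_finite_verts finite_subset[OF sub pair_finite_arcs]
    by unfold_locales simp_all
qed

lemma finite_uedges: "pair_graph G \<Longrightarrow> finite (uedges G)"
proof -
  assume "pair_graph G"
  then interpret pair_graph G .
  have "uedges G = (\<lambda>(u, v). {u, v}) ` parcs G"
    by (auto simp: uedges_def image_def)
  then show ?thesis using pair_finite_arcs by simp
qed

lemma gdist_eq_INF_length:
  assumes "pair_graph G"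
  shows "gdist G s t =
    (INF p \<in> {p. pre_digraph.awalk (with_proj G) s p t}. ereal (real (length p)))"
proof -
  interpret pair_graph G by fact
  have "awalk_cost (\<lambda>_. 1) p = real (length p)" for p :: "('a \<times> 'a) list"
    by (induction p) auto
  then show ?thesis by (simp add: gdist_def \<mu>_def)
qed

end

theory Submission
  imports Defs "HOL-Library.Nat_Bijection"
begin

text \<open>
  Give the arcs positive weights \<open>w (u, v) = M + r (u, v)\<close> with tiny antisymmetric perturbations \<open>r\<close>
  such that in every subgraph the lightest walk \<open>\<pi>(s, v | F)\<close> from \<open>s\<close> to \<open>v\<close> avoiding \<open>F\<close> is unique
  and has the fewest arcs. Antisymmetry implies that a shortest walk from \<open>s\<close> to \<open>t\<close> avoiding \<open>F\<close>
  can be taken to be \<open>\<pi>(s, x | F - {e})\<close> followed by the reverse of \<open>\<pi>(t, x | F - {e})\<close>, for any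
  \<open>e \<in> F\<close> and a suitable \<open>x\<close>. Hence the union of all \<open>\<pi>(s, v | F)\<close> with \<open>s \<in> S\<close> and \<open>|F| \<le> f\<close> tolerates
  \<open>f + 1\<close> faults.

  To bound the size of the union, count the last arcs of these walks for a fixed \<open>v\<close>, by induction
  on \<open>f\<close>. One may assume that each fault lies on the walk that avoids the previous ones; record its
  position, counted from \<open>v\<close>. With \<open>N = n / |S|\<close>, if the \<open>i\<close>-th largest position is \<open>O(N ^ (1 / 2 ^ i))\<close> for all
  \<open>i\<close>, the positions and \<open>s\<close> determine the walk, which leaves \<open>O(|S| N ^ (1 / 2 + 1 / 4 + \<dots>))\<close> possibilities.
  Otherwise \<open>i\<close> faults are so far from \<open>v\<close> that they are irrelevant for the walks from the last
  \<open>N ^ (1 / 2 ^ i)\<close> vertices, and a hitting set of these vertices serves as a new source set for \<open>f - i\<close>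
  faults.
\<close>

subsection \<open>Walks of minimal weight\<close>

fun walk :: "('a \<times> 'a) set \<Rightarrow> 'a \<Rightarrow> ('a \<times> 'a) list \<Rightarrow> 'a \<Rightarrow> bool" where
  "walk B s [] t \<longleftrightarrow> s = t"
| "walk B s (a # p) t \<longleftrightarrow> fst a = s \<and> a \<in> B \<and> walk B (snd a) p t"

lemma walk_append: "walk B s (p @ q) t \<longleftrightarrow> (\<exists>x. walk B s p x \<and> walk B x q t)"
  by (induction p arbitrary: s) auto

lemma walk_set: "walk B s p t \<Longrightarrow> set p \<subseteq> B"
  by (induction p arbitrary: s) auto

lemma walk_restrict: "walk B s p t \<Longrightarrow> set p \<subseteq> C \<Longrightarrow> walk C s p t"
  by (induction p arbitrary: s) auto

lemma walk_mono: "walk B s p t \<Longrightarrow> B \<subseteq> C \<Longrightarrow> walk C s p t"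
  by (induction p arbitrary: s) auto

lemma walk_rev:
  assumes "sym B" "walk B s p t"
  shows "walk B t (rev (map prod.swap p)) s"
  using assms(2) by (induction p arbitrary: s) (use assms(1) in \<open>auto simp: walk_append sym_def\<close>)

lemma walk_split_at:
  assumes "walk B s p t" "x \<in> set (map fst p)"
  shows "\<exists>p1 p2. p = p1 @ p2 \<and> walk B s p1 x \<and> walk B x p2 t \<and> p2 \<noteq> []"
proof -
  obtain a where "a \<in> set p" "fst a = x" using assms(2) by auto
  then obtain p1 p2 where "p = p1 @ a # p2" by (meson split_list)
  then show ?thesis using assms(1) \<open>fst a = x\<close>
    by (intro exI[of _ p1] exI[of _ "a # p2"]) (auto simp: walk_append)
qed

lemma walk_avoid_or_split:
  assumes "walk B s p t" "\<not> set p \<subseteq> C"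
  shows "\<exists>p1 a p2. p = p1 @ a # p2 \<and> set p1 \<subseteq> C \<and> a \<in> B - C \<and>
           walk B s p1 (fst a) \<and> walk B (snd a) p2 t"
proof -
  have "\<exists>a \<in> set p. a \<notin> C" using assms(2) by auto
  then obtain p1 a p2 where "p = p1 @ a # p2" "a \<notin> C" "\<forall>x \<in> set p1. \<not> x \<notin> C"
    using split_list_first_prop[of p "\<lambda>x. x \<notin> C"] by blast
  then show ?thesis using assms(1)
    by (intro exI[of _ p1] exI[of _ a] exI[of _ p2]) (auto simp: walk_append)
qed

lemma walk_transition:
  assumes "walk B s p t" "Q s" "\<not> Q t"
  shows "\<exists>p1 a p2. p = p1 @ a # p2 \<and> walk B s p1 (fst a) \<and> a \<in> B \<and> walk B (snd a) p2 t \<and>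
           Q (fst a) \<and> \<not> Q (snd a)"
  using assms
proof (induction p arbitrary: s)
  case Nil
  then show ?case by auto
next
  case (Cons a p)
  show ?case
  proof (cases "Q (snd a)")
    case True
    then obtain p1 c p2 where "p = p1 @ c # p2" "walk B (snd a) p1 (fst c)" "c \<in> B"
      "walk B (snd c) p2 t" "Q (fst c)" "\<not> Q (snd c)"
      using Cons.IH[of "snd a"] Cons.prems by auto
    then show ?thesis using Cons.prems
      by (intro exI[of _ "a # p1"] exI[of _ c] exI[of _ p2]) auto
  next
    case False
    then show ?thesis using Cons.prems
      by (intro exI[of _ "[]"] exI[of _ a] exI[of _ p]) auto
  qed
qed

text \<open>With distinct tails, a single arc of the set leaves \<open>s\<close>, so the walk can be
  read off arc by arc. The uniqueness proof for lightest walks ends with this.\<close>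

lemma simple_walk_set_inject:
  assumes "walk B s p t" "walk C s q t" "set p = set q"
    "distinct (map fst p)" "distinct (map fst q)"
  shows "p = q"
  using assms
proof (induction p arbitrary: s q)
  case Nil
  then show ?case by auto
next
  case (Cons a p)
  from Cons.prems(3) obtain c q' where q: "q = c # q'" by (cases q) auto
  have ac: "a = c"
  proof -
    have "a \<in> set q" "fst a = fst c" using Cons.prems q by auto
    then show ?thesis using Cons.prems(5) q by (metis distinct_map inj_onD list.set_intros(1))
  qed
  have "a \<notin> set p" "a \<notin> set q'" using Cons.prems(4,5) q ac by auto
  then have "set p = set q'" using Cons.prems(3) q ac by auto
  then have "p = q'" using Cons.IH[of "snd a" q'] Cons.prems q ac by auto
  then show ?case using q ac by simp
qed

abbreviation cost :: "('b \<Rightarrow> int) \<Rightarrow> 'b list \<Rightarrow> int" where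
  "cost w p \<equiv> sum_list (map w p)"

definition sp :: "('a \<times> 'a \<Rightarrow> int) \<Rightarrow> ('a \<times> 'a) set \<Rightarrow> 'a \<Rightarrow> ('a \<times> 'a) list \<Rightarrow> 'a \<Rightarrow> bool" where
  "sp w B s p t \<longleftrightarrow> walk B s p t \<and> (\<forall>q. walk B s q t \<longrightarrow> cost w p \<le> cost w q)"

lemma sp_walk: "sp w B s p t \<Longrightarrow> walk B s p t"
  by (simp add: sp_def)

lemma sp_le: "sp w B s p t \<Longrightarrow> walk B s q t \<Longrightarrow> cost w p \<le> cost w q"
  by (simp add: sp_def)

lemma sp_subset: "sp w B s p t \<Longrightarrow> C \<subseteq> B \<Longrightarrow> set p \<subseteq> C \<Longrightarrow> sp w C s p t"
  unfolding sp_def by (auto intro: walk_restrict walk_mono)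

lemma sp_appendD:
  assumes "sp w B s (p @ q) t" "walk B s p x" "walk B x q t"
  shows "sp w B s p x" "sp w B x q t"
proof -
  have *: "cost w p + cost w q \<le> cost w p' + cost w q'" if "walk B s p' x" "walk B x q' t" for p' q'
    using sp_le[OF assms(1), of "p' @ q'"] that by (auto simp: walk_append)
  show "sp w B s p x" unfolding sp_def using *[OF _ assms(3)] assms(2) by auto
  show "sp w B x q t" unfolding sp_def using *[OF assms(2)] assms(3) by auto
qed

lemma cost_nonneg: "(\<And>a. a \<in> set p \<Longrightarrow> w a > 0) \<Longrightarrow> cost w p \<ge> 0"
  by (induction p) (simp_all add: order_less_imp_le)

lemma sp_exists:
  assumes "walk B s q t" "\<And>a. a \<in> B \<Longrightarrow> w a > 0"
  shows "\<exists>p. sp w B s p t"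
proof -
  obtain p where p: "walk B s p t"
    and least: "\<forall>q. walk B s q t \<longrightarrow> nat (cost w p) \<le> nat (cost w q)"
    using ex_has_least_nat[of "\<lambda>p. walk B s p t" q "\<lambda>p. nat (cost w p)"] assms(1) by blast
  have "cost w p \<le> cost w q" if q: "walk B s q t" for q
  proof -
    have "cost w q \<ge> 0" using walk_set[OF q] assms(2) by (intro cost_nonneg) auto
    then show ?thesis using least[rule_format, OF q] by linarith
  qed
  then have "sp w B s p t" unfolding sp_def using p by simp
  then show ?thesis by blast
qed

text \<open>A return to the start could be cut out, saving at least the positive weight of the first
  arc \<open>a\<close>.\<close>

lemma sp_distinct:
  assumes sp: "sp w B s p t" and pos: "\<And>a. a \<in> B \<Longrightarrow> w a > 0"
  shows "distinct (map fst p @ [t])"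
  using sp
proof (induction p arbitrary: s)
  case Nil
  then show ?case by simp
next
  case (Cons a p)
  have wk: "fst a = s" "a \<in> B" "walk B (snd a) p t" using sp_walk[OF Cons.prems] by auto
  have "sp w B (snd a) p t"
    using sp_appendD(2)[of w B s "[a]" p t] Cons.prems wk by simp
  then have IH: "distinct (map fst p @ [t])" by (rule Cons.IH)
  have shorter: False if "p = p1 @ p2" "walk B s p2 t" for p1 p2
  proof -
    have "cost w p1 \<ge> 0" using that wk(3) pos walk_set by (intro cost_nonneg) fastforce
    then show False using sp_le[OF Cons.prems that(2)] that(1) pos[OF wk(2)] by simp
  qed
  have "s \<notin> set (map fst p)"
    using walk_split_at[OF wk(3), of s] shorter by blast
  moreover have "s \<noteq> t" using shorter[of p "[]"] by auto
  ultimately show ?case using IH wk by auto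
qed

subsection \<open>Antisymmetric tie-breaking weights\<close>

text \<open>The last three assumptions are what tie-breaking must provide. Length minimality and
  uniqueness are demanded for every \<open>B \<subseteq> A\<close>, so that one weight function
  serves all fault sets at once. \<open>antisym_weight\<close> gives all edges the same total weight
  over their two directions, which is used only in the restoration argument.\<close>

locale unique_walks =
  fixes V :: "'a set" and A :: "('a \<times> 'a) set" and w :: "'a \<times> 'a \<Rightarrow> int" and M :: int
  assumes finite_V: "finite V"
    and arcs_subset: "A \<subseteq> V \<times> V"
    and sym_arcs: "sym A"
    and pos: "\<And>a. a \<in> A \<Longrightarrow> w a > 0"
    and antisym_weight: "\<And>u v. (u, v) \<in> A \<Longrightarrow> w (u, v) + w (v, u) = 2 * M"
    and sp_length_le: "\<And>B s p t q. B \<subseteq> A \<Longrightarrow> sp w B s p t \<Longrightarrow> walk B s q t \<Longrightarrow> length p \<le> length q"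
    and sp_unique: "\<And>B s p t q. B \<subseteq> A \<Longrightarrow> sp w B s p t \<Longrightarrow> sp w B s q t \<Longrightarrow> p = q"

text \<open>Modulo 3 the sum reduces to \<open>c 0\<close>, and 0 is the only multiple of 3 of
  absolute value at most 2. Dividing by 3 then shifts the digits.\<close>

lemma zero_digits:
  fixes c :: "nat \<Rightarrow> int"
  assumes "(\<Sum>i<m. c i * 3 ^ i) = 0" "\<And>i. i < m \<Longrightarrow> \<bar>c i\<bar> \<le> 2" "i < m"
  shows "c i = 0"
  using assms
proof (induction m arbitrary: c i)
  case 0
  then show ?case by simp
next
  case (Suc m)
  have split: "c 0 + 3 * (\<Sum>i<m. c (Suc i) * 3 ^ i) = 0"
    using Suc.prems(1) unfolding sum.lessThan_Suc_shift
    by (simp add: sum_distrib_left mult_ac)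
  then have "3 dvd c 0" by presburger
  then have c0: "c 0 = 0" using Suc.prems(2)[of 0] by presburger
  have "c (Suc j) = 0" if "j < m" for j
    using Suc.IH[of "\<lambda>i. c (Suc i)" j] split c0 Suc.prems(2) that by auto
  then show ?case using c0 Suc.prems(3) by (cases i) auto
qed

text \<open>Needed so that the two directions of an edge never cancel in the perturbation of a
  simple walk: the digit of an edge then reveals whether and in which direction it is used.\<close>

lemma simple_walk_no_reversal:
  assumes "walk B s p t" "distinct (map fst p @ [t])" "(u, v) \<in> set p"
  shows "(v, u) \<notin> set p"
proof -
  have snd_in: "snd a \<in> set (map fst p') \<union> {t}" if "walk B x p' t" "a \<in> set p'"
    for p' x and a :: "'a \<times> 'a"
    using that
  proof (induction p' arbitrary: x)
    case (Cons b p')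
    then show ?case by (cases p') auto
  qed simp
  show ?thesis using assms
  proof (induction p arbitrary: s)
    case (Cons b p)
    then have b: "fst b = s" "walk B (snd b) p t" by auto
    have no: "s \<notin> set (map fst p) \<union> {t}" using Cons.prems(2) b by auto
    then have notin: "snd a \<noteq> s" if "a \<in> set (b # p)" for a
    proof (cases "a \<in> set p")
      case True
      then show ?thesis using snd_in[OF b(2) True] no by auto
    next
      case False
      then have "a = b" using that by simp
      then show ?thesis using b(2) no by (cases p) auto
    qed
    show ?case
    proof (cases "(u, v) \<in> set p \<and> (v, u) \<in> set p")
      case True
      then show ?thesis using Cons.IH[OF b(2)] Cons.prems(2) by auto
    next
      case False
      then have "(u, v) = b \<or> (v, u) \<noteq> b \<and> (v, u) \<notin> set p \<or> (v, u) = b" using Cons.prems(3) by auto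
      then show ?thesis using notin[of "(u, v)"] notin[of "(v, u)"] Cons.prems(3) b(1) by fastforce
    qed
  qed simp
qed

text \<open>The perturbation of the arc \<open>(u, v)\<close> is \<open>\<plusminus>3\<^sup>i\<close>, with \<open>i\<close> encoding the edge \<open>{u, v}\<close>.
  Since a simple walk contributes a digit in \<open>{-1, 0, 1}\<close> at each position \<open>i\<close>, the
  difference of two such contributions vanishes only if the walks have the same arcs.\<close>

lemma ex_unique_walks:
  fixes A :: "('a \<times> 'a) set"
  assumes fin: "finite V" and AV: "A \<subseteq> V \<times> V" and symA: "sym A"
    and noloop: "\<And>v. (v, v) \<notin> A"
  shows "\<exists>w M. unique_walks V A w M"
proof -
  obtain h :: "'a \<Rightarrow> nat" where h: "inj_on h V"
    using finite_imp_inj_to_nat_seg[OF fin] by blast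
  \<comment> \<open>Taking \<open>min\<close> and \<open>max\<close> makes both directions of an
    edge share one index, while different edges get different ones.\<close>
  define idx where "idx a = prod_encode (min (h (fst a)) (h (snd a)), max (h (fst a)) (h (snd a)))"
    for a
  define sg :: "'a \<times> 'a \<Rightarrow> int" where "sg a = (if h (fst a) < h (snd a) then 1 else - 1)" for a
  define r where "r a = sg a * 3 ^ idx a" for a
  have finA: "finite A" using fin AV finite_subset by blast
  define K where "K = (\<Sum>a\<in>A. \<bar>r a\<bar>)"
  \<comment> \<open>The perturbations of two simple walks differ by at most \<open>2 * K\<close>, so
    an additional arc always outweighs them.\<close>
  define M where "M = 2 * K + 1"
  define w where "w a = M + r a" for a
  have K0: "K \<ge> 0" unfolding K_def by (simp add: sum_nonneg)
  have rK: "\<bar>r a\<bar> \<le> K" if "a \<in> A" for a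
    unfolding K_def using finA that member_le_sum[of a A "\<lambda>a. \<bar>r a\<bar>"] by simp
  have pos: "w a > 0" if "a \<in> A" for a
    using rK[OF that] K0 unfolding w_def M_def by linarith
  have swapA: "(v, u) \<in> A" if "(u, v) \<in> A" for u v using symA that by (meson symD)
  have idx_eq: "idx a = idx (u, v) \<longleftrightarrow> a = (u, v) \<or> a = (v, u)" if "a \<in> A" "(u, v) \<in> A" for a u v
  proof -
    obtain x y where a: "a = (x, y)" by (cases a)
    have "x \<in> V" "y \<in> V" "u \<in> V" "v \<in> V" using that AV a by auto
    then have *: "h x = h u \<longleftrightarrow> x = u" "h x = h v \<longleftrightarrow> x = v" "h y = h u \<longleftrightarrow> y = u" "h y = h v \<longleftrightarrow> y = v"
      using h by (auto simp: inj_on_def)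
    have "idx a = idx (u, v) \<longleftrightarrow> h x = h u \<and> h y = h v \<or> h x = h v \<and> h y = h u"
      by (auto simp: idx_def a min_def max_def)
    then show ?thesis unfolding * a by auto
  qed
  have sg_swap: "sg (v, u) = - sg (u, v)" if "(u, v) \<in> A" for u v
  proof -
    have "h u \<noteq> h v" using that AV h noloop[of u] by (auto simp: inj_on_def)
    then show ?thesis by (auto simp: sg_def)
  qed
  have sg1: "\<bar>sg a\<bar> = 1" for a by (simp add: sg_def)
  have idx_swap: "idx (v, u) = idx (u, v)" for u v by (simp add: idx_def min.commute max.commute)
  have cost_w: "cost w p = M * int (length p) + cost r p" for p
    by (induction p) (auto simp: w_def algebra_simps)
  have cost_r: "\<bar>cost r p\<bar> \<le> K" if "set p \<subseteq> A" "distinct p" for p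
  proof -
    have "\<bar>cost r p\<bar> = \<bar>\<Sum>a\<in>set p. r a\<bar>"
      using that by (simp add: sum_list_distinct_conv_sum_set)
    also have "\<dots> \<le> (\<Sum>a\<in>set p. \<bar>r a\<bar>)" by (rule sum_abs)
    also have "\<dots> \<le> K" unfolding K_def using that finA by (intro sum_mono2) auto
    finally show ?thesis .
  qed
  have hop: "length p \<le> length q"
    if B: "B \<subseteq> A" and p: "sp w B s p t" and q: "walk B s q t" for B s p t q
  proof -
    \<comment> \<open>The walk \<open>q\<close> may repeat arcs, and then \<open>cost_r\<close> does
      not bound its perturbation. A walk with fewest arcs is simple and replaces it.\<close>
    obtain q0 where q0: "sp (\<lambda>_. 1) B s q0 t" using sp_exists[OF q, of "\<lambda>_. 1"] by auto
    have le: "length q0 \<le> length q"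
      using sp_le[OF q0 q] by (simp add: sum_list_triv)
    have d: "distinct p" "distinct q0"
      using sp_distinct[OF p] pos B sp_distinct[OF q0] by (auto simp: distinct_map)
    have "cost w p \<le> cost w q0" using sp_le[OF p sp_walk[OF q0]] .
    moreover have "\<bar>cost r p\<bar> \<le> K" "\<bar>cost r q0\<bar> \<le> K"
      using cost_r d walk_set[OF sp_walk[OF p]] walk_set[OF sp_walk[OF q0]] B by blast+
    ultimately have lt: "M * int (length p) < M * int (length q0) + M"
      unfolding cost_w M_def by linarith
    have "length p \<le> length q0"
    proof (rule ccontr)
      assume "\<not> ?thesis"
      then have "int (length q0) + 1 \<le> int (length p)" by simp
      then have "M * (int (length q0) + 1) \<le> M * int (length p)"
        using K0 unfolding M_def by (intro mult_left_mono) auto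
      then show False using lt by (simp add: algebra_simps)
    qed
    then show ?thesis using le by simp
  qed
  define m where "m = Suc (Max (idx ` A))"
  have idx_m: "idx a < m" if "a \<in> A" for a
    unfolding m_def using finA that by (simp add: le_imp_less_Suc)
  define c where "c X i = (\<Sum>a\<in>{a \<in> X. idx a = i}. sg a)" for X i
  have c_eq: "c X (idx (u, v)) = (if (u, v) \<in> X then sg (u, v) else if (v, u) \<in> X then - sg (u, v) else 0)"
    if X: "X \<subseteq> A" "\<And>u v. (u, v) \<in> X \<Longrightarrow> (v, u) \<notin> X" and uv: "(u, v) \<in> A" for X u v
  proof -
    have "{a \<in> X. idx a = idx (u, v)} = X \<inter> {(u, v), (v, u)}"
      using idx_eq[OF _ uv] X(1) by auto
    also have "\<dots> = (if (u, v) \<in> X then {(u, v)} else if (v, u) \<in> X then {(v, u)} else {})"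
      using X(2) by auto
    finally show ?thesis unfolding c_def using sg_swap[OF uv] by auto
  qed
  have c_bound: "\<bar>c X i\<bar> \<le> 1"
    if X: "X \<subseteq> A" "\<And>u v. (u, v) \<in> X \<Longrightarrow> (v, u) \<notin> X" for X i
  proof (cases "\<exists>u v. (u, v) \<in> A \<and> idx (u, v) = i")
    case True
    then show ?thesis using c_eq[OF X] sg1 by fastforce
  next
    case False
    then have "{a \<in> X. idx a = i} = {}" using X(1) by fastforce
    then show ?thesis unfolding c_def by (simp only: sum.empty)
  qed
  have sum_c: "(\<Sum>a\<in>X. r a) = (\<Sum>i<m. c X i * 3 ^ i)" if X: "X \<subseteq> A" for X
  proof -
    have "(\<Sum>a\<in>X. r a) = (\<Sum>i<m. \<Sum>a\<in>{a \<in> X. idx a = i}. r a)"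
      using finite_subset[OF X finA] idx_m X by (intro sum.group[symmetric]) auto
    also have "\<dots> = (\<Sum>i<m. c X i * 3 ^ i)"
      unfolding c_def r_def by (intro sum.cong) (auto simp: sum_distrib_right)
    finally show ?thesis .
  qed
  have uniq: "p = q" if B: "B \<subseteq> A" and p: "sp w B s p t" and q: "sp w B s q t" for B s p t q
  proof -
    have wk: "walk B s p t" "walk B s q t" using p q by (auto intro: sp_walk)
    have dist: "distinct (map fst p @ [t])" "distinct (map fst q @ [t])"
      using sp_distinct[OF p] sp_distinct[OF q] pos B by blast+
    have sub: "set p \<subseteq> A" "set q \<subseteq> A" using walk_set[OF wk(1)] walk_set[OF wk(2)] B by auto
    have len: "length p = length q" using hop[OF B p wk(2)] hop[OF B q wk(1)] by simp
    have "cost w p = cost w q" using sp_le[OF p wk(2)] sp_le[OF q wk(1)] by simp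
    then have "cost r p = cost r q" unfolding cost_w using len by simp
    then have "(\<Sum>a\<in>set p. r a) = (\<Sum>a\<in>set q. r a)"
      using dist by (simp add: sum_list_distinct_conv_sum_set distinct_map)
    then have "(\<Sum>i<m. (c (set p) i - c (set q) i) * 3 ^ i) = 0"
      using sum_c[OF sub(1)] sum_c[OF sub(2)] by (simp add: left_diff_distrib sum_subtractf)
    moreover have norev: "(v, u) \<notin> set p" if "(u, v) \<in> set p" for u v
      using simple_walk_no_reversal[OF wk(1) dist(1)] that .
    moreover have norev': "(v, u) \<notin> set q" if "(u, v) \<in> set q" for u v
      using simple_walk_no_reversal[OF wk(2) dist(2)] that .
    moreover have "\<bar>c (set p) i - c (set q) i\<bar> \<le> 2" for i
      using c_bound[OF sub(1) norev, of i] c_bound[OF sub(2) norev', of i] by linarith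
    ultimately have ceq: "c (set p) i = c (set q) i" if "i < m" for i
      using zero_digits[of "\<lambda>i. c (set p) i - c (set q) i" m i] that by simp
    have "a \<in> set p \<longleftrightarrow> a \<in> set q" if a: "a \<in> A" for a
    proof -
      obtain u v where uv: "a = (u, v)" by (cases a)
      \<comment> \<open>The digit at this edge is \<open>sg (u, v)\<close>, its negative or 0, three
        different values that tell which direction, if any, is used.\<close>
      have "sg (u, v) \<noteq> 0" "sg (u, v) \<noteq> - sg (u, v)" using sg1[of "(u, v)"] by auto
      moreover have "c (set p) (idx (u, v)) = c (set q) (idx (u, v))"
        using ceq[OF idx_m[OF a]] uv by simp
      moreover have "(v, u) \<notin> set p" if "(u, v) \<in> set p" using norev that .
      moreover have "(v, u) \<notin> set q" if "(u, v) \<in> set q" using norev' that .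
      ultimately show ?thesis
        using c_eq[OF sub(1) norev, of u v] c_eq[OF sub(2) norev', of u v] a uv
        by (auto split: if_split_asm)
    qed
    then have "set p = set q" using sub by blast
    then show ?thesis using simple_walk_set_inject[OF wk] dist by simp
  qed
  have "w (u, v) + w (v, u) = 2 * M" if "(u, v) \<in> A" for u v
    using sg_swap[OF that] idx_swap[of v u] by (simp add: w_def r_def)
  then have "unique_walks V A w M"
    using fin AV symA pos hop uniq by unfold_locales blast+
  then show ?thesis by blast
qed

subsection \<open>Restoration\<close>

context unique_walks
begin

text \<open>The vertex \<open>x\<close> is the endpoint of an arc \<open>(x, y)\<close> of a shortest walk avoiding
  the edge \<open>{c, d}\<close> such that the shortest walk from \<open>s\<close> to \<open>x\<close> avoids the edge, but the one to \<open>y\<close>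
  does not.\<close>

lemma restoration:
  assumes BA: "B \<subseteq> A" and symB: "sym B" and wP: "walk (B - {(c, d), (d, c)}) s P t"
  shows "\<exists>x p q. sp w B s p x \<and> sp w B t q x \<and> set p \<subseteq> B - {(c, d), (d, c)} \<and>
           set q \<subseteq> B - {(c, d), (d, c)} \<and> length p + length q \<le> length P"
proof -
  define B' where "B' = B - {(c, d), (d, c)}"
  have B'B: "B' \<subseteq> B" and B'A: "B' \<subseteq> A" using BA by (auto simp: B'_def)
  have symB': "sym B'" using symB by (auto simp: B'_def sym_def)
  have posB: "\<And>a. a \<in> B \<Longrightarrow> w a > 0" using BA pos by blast
  have spB: "\<exists>p. sp w B a p b" if "walk B a q b" for a b q
    using sp_exists[OF that] posB by simp
  obtain P' where P': "sp w B' s P' t"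
    using sp_exists[OF wP[folded B'_def]] posB B'B by blast
  have wP': "walk B' s P' t" by (rule sp_walk[OF P'])
  have leP: "length P' \<le> length P" using sp_length_le[OF B'A P' wP[folded B'_def]] .
  have sp_Nil: "sp w B x [] x" for x
  proof -
    have "0 \<le> cost w q" if "walk B x q x" for q
      using walk_set[OF that] posB by (intro cost_nonneg) auto
    then show ?thesis unfolding sp_def by simp
  qed
  define good where "good x \<longleftrightarrow> (\<exists>p. sp w B s p x \<and> set p \<subseteq> B')" for x
  have "good s"
    unfolding good_def using sp_Nil[of s] by (intro exI[of _ "[]"]) simp
  show ?thesis
  proof (cases "good t")
    case True
    \<comment> \<open>Here \<open>t\<close> itself is the meeting vertex and the second walk is
      empty.\<close>
    then obtain p where p: "sp w B s p t" "set p \<subseteq> B'" unfolding good_def by blast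
    have "length p \<le> length P"
      using sp_length_le[OF BA p(1) walk_mono[OF wP]] by blast
    then show ?thesis using p sp_Nil[of t] unfolding B'_def
      by (intro exI[of _ t] exI[of _ p] exI[of _ "[]"]) simp
  next
    case False
    from walk_transition[of B' s P' t good, OF wP' \<open>good s\<close> False]
    obtain P1 xy P2 where split: "P' = P1 @ xy # P2" "walk B' s P1 (fst xy)" "xy \<in> B'"
      "walk B' (snd xy) P2 t" "good (fst xy)" "\<not> good (snd xy)" by blast
    obtain x y where xy: "xy = (x, y)" by (cases xy)
    note split = split[unfolded xy fst_conv snd_conv]
    obtain p where p: "sp w B s p x" "set p \<subseteq> B'" using split(5) unfolding good_def by blast
    have xyB: "(x, y) \<in> B" and yxB: "(y, x) \<in> B" using split(3) B'B symB by (auto simp: sym_def)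
    have P1y: "walk B s (P1 @ [(x, y)]) y"
      using walk_mono[OF split(2) B'B] xyB by (auto simp: walk_append)
    from spB[OF P1y] obtain py where py: "sp w B s py y" ..
    have "\<not> set py \<subseteq> B'" using split(6) py unfolding good_def by blast
    from walk_avoid_or_split[OF sp_walk[OF py] this]
    obtain p1 uv p2 where ps: "py = p1 @ uv # p2" "set p1 \<subseteq> B'" "uv \<in> B - B'"
      "walk B s p1 (fst uv)" "walk B (snd uv) p2 y" by blast
    obtain u v where uv: "uv = (u, v)" by (cases uv)
    note ps = ps[unfolded uv fst_conv snd_conv]
    have cd: "{u, v} = {c, d}" using ps(3) unfolding B'_def by auto
    \<comment> \<open>Following \<open>P'\<close> backwards from \<open>t\<close> to
      \<open>x\<close> bounds the length of \<open>q\<close>.\<close>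
    have wrev: "walk B' t (rev (map prod.swap P2) @ [(y, x)]) x"
      using walk_rev[OF symB' split(4)] split(3) symB' by (auto simp: walk_append sym_def)
    from spB[OF walk_mono[OF wrev B'B]] obtain q where q: "sp w B t q x" ..
    have lenq: "length q \<le> Suc (length P2)"
      using sp_length_le[OF BA q walk_mono[OF wrev B'B]] by simp
    have lenp: "length p \<le> length P1"
      using sp_length_le[OF BA p(1) walk_mono[OF split(2) B'B]] .
    have uvA: "(u, v) \<in> A" and xyA: "(x, y) \<in> A" using ps(3) xyB BA by auto
    have "set q \<subseteq> B'"
    proof (rule ccontr)
      assume "\<not> set q \<subseteq> B'"
      from walk_avoid_or_split[OF sp_walk[OF q] this]
      obtain q1 a q2 where qs: "q = q1 @ a # q2" "set q1 \<subseteq> B'" "a \<in> B - B'"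
        "walk B t q1 (fst a)" "walk B (snd a) q2 x" by blast
      have "a = (u, v) \<or> a = (v, u)" using qs(3) cd unfolding B'_def by (auto simp: doubleton_eq_iff)
      then show False
      proof
        \<comment> \<open>Both walks reach \<open>u\<close> before using the edge. Joining
          \<open>p1\<close> to the reverse of \<open>q1\<close> bypasses it within at most
          \<open>length P1 + length P2\<close> arcs, fewer than the shortest walk \<open>P'\<close>
          has.\<close>
        assume a: "a = (u, v)"
        have "walk B' s p1 u" using walk_restrict[OF ps(4,2)] .
        moreover have "walk B' u (rev (map prod.swap q1)) t"
          using walk_rev[OF symB' walk_restrict[OF qs(4,2)]] a by simp
        ultimately have "walk B' s (p1 @ rev (map prod.swap q1)) t" by (auto simp: walk_append)
        then have "length P' \<le> length p1 + length q1"
          using sp_length_le[OF B'A P'] by fastforce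
        moreover have "length py \<le> Suc (length P1)"
          using sp_length_le[OF BA py P1y] by simp
        ultimately show False using lenq qs(1) ps(1) split(1) by simp
      next
        \<comment> \<open>The edge is crossed in opposite directions, so the pieces can be
          exchanged: \<open>p1\<close> with \<open>q2\<close> leads to \<open>x\<close>, and
          \<open>q1\<close> with \<open>p2\<close> and \<open>(y, x)\<close> does as well. Adding
          the three cost inequalities, the first of them strict by uniqueness, leaves
          \<open>w (u, v) + w (v, u) < w (x, y) + w (y, x)\<close>, although both sides equal
          \<open>2 * M\<close>.\<close>
        assume a: "a = (v, u)"
        have wp: "walk B s (p @ [(x, y)]) y"
          using sp_walk[OF p(1)] xyB by (auto simp: walk_append)
        have "cost w py < cost w (p @ [(x, y)])"
        proof (rule ccontr)
          assume "\<not> ?thesis"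
          then have "sp w B s (p @ [(x, y)]) y" using py wp unfolding sp_def by fastforce
          then have "py = p @ [(x, y)]" using sp_unique[OF BA py] by blast
          then show False using \<open>\<not> set py \<subseteq> B'\<close> p(2) split(3) by auto
        qed
        moreover have "cost w p \<le> cost w (p1 @ q2)"
          using ps(4) qs(5) a by (intro sp_le[OF p(1)]) (auto simp: walk_append)
        moreover have "cost w q \<le> cost w (q1 @ p2 @ [(y, x)])"
          using ps(5) qs(4) a yxB by (intro sp_le[OF q]) (auto simp: walk_append)
        moreover have "w (u, v) + w (v, u) = 2 * M" "w (x, y) + w (y, x) = 2 * M"
          using antisym_weight[OF uvA] antisym_weight[OF xyA] .
        ultimately show False using ps(1) qs(1) a by simp
      qed
    qed
    then show ?thesis using p q lenp lenq leP split(1) unfolding B'_def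
      by (intro exI[of _ x] exI[of _ p] exI[of _ q]) auto
  qed
qed

end

subsection \<open>Counting tools\<close>

text \<open>Lists \<open>Ds\<close> whose entries, sorted decreasingly, are bounded by \<open>b 1, b 2, \<dots>\<close>.\<close>

definition dominated :: "(nat \<Rightarrow> nat) \<Rightarrow> nat \<Rightarrow> nat list set" where
  "dominated b j = {Ds. length Ds = j \<and> (\<forall>D \<in> set Ds. 1 \<le> D) \<and>
     (\<forall>i \<in> {1..j}. length (filter (\<lambda>D. b i < D) Ds) < i)}"

text \<open>Some entry is at most \<open>b j\<close>; removing it leaves an element of \<open>dominated b (j - 1)\<close>.\<close>

lemma card_dominated: "finite (dominated b j) \<and> card (dominated b j) \<le> fact j * (\<Prod>i=1..j. b i)"
proof (induction j)
  case 0
  have "dominated b 0 = {[]}" by (auto simp: dominated_def)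
  then show ?case by simp
next
  case (Suc j)
  define ins where "ins = (\<lambda>(t, D, Rs). take t Rs @ D # drop t Rs :: nat list)"
  \<comment> \<open>The position of the removed entry accounts for the growth of the factorial, its
    value for the factor \<open>b (Suc j)\<close>.\<close>
  define X where "X = {..<Suc j} \<times> {1..b (Suc j)} \<times> dominated b j"
  have "dominated b (Suc j) \<subseteq> ins ` X"
  proof
    fix Ds assume Ds: "Ds \<in> dominated b (Suc j)"
    then have len: "length Ds = Suc j" and ge1: "\<forall>D \<in> set Ds. 1 \<le> D"
      and small: "\<And>i. i \<in> {1..Suc j} \<Longrightarrow> length (filter (\<lambda>D. b i < D) Ds) < i"
      by (auto simp: dominated_def)
    have "\<not> (\<forall>D \<in> set Ds. b (Suc j) < D)"
    proof
      assume "\<forall>D \<in> set Ds. b (Suc j) < D"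
      then have "filter (\<lambda>D. b (Suc j) < D) Ds = Ds" by simp
      then show False using small[of "Suc j"] len by simp
    qed
    then obtain t where t: "t < Suc j" "Ds ! t \<le> b (Suc j)"
      using len by (metis in_set_conv_nth not_less)
    define Rs where "Rs = take t Ds @ drop (Suc t) Ds"
    have split: "Ds = take t Ds @ Ds ! t # drop (Suc t) Ds"
      using t(1) len by (simp add: id_take_nth_drop)
    have filter_le: "length (filter P Rs) \<le> length (filter P Ds)" for P
      using arg_cong[OF split, of "\<lambda>xs. length (filter P xs)"] by (simp add: Rs_def)
    have "length (filter (\<lambda>D. b i < D) Rs) < i" if "i \<in> {1..j}" for i
      using le_less_trans[OF filter_le small[of i]] that by simp
    then have "Rs \<in> dominated b j"
      using ge1 len t(1) unfolding dominated_def Rs_def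
      by (auto dest: in_set_takeD in_set_dropD)
    moreover have "ins (t, Ds ! t, Rs) = Ds"
      using split t(1) len by (simp add: ins_def Rs_def min_def)
    moreover have "1 \<le> Ds ! t" using ge1 t(1) len by simp
    ultimately show "Ds \<in> ins ` X" using t unfolding X_def by force
  qed
  moreover have "finite X" using Suc.IH by (simp add: X_def)
  ultimately have "finite (dominated b (Suc j))" "card (dominated b (Suc j)) \<le> card X"
    by (auto intro: finite_subset surj_card_le)
  moreover have "card X = Suc j * b (Suc j) * card (dominated b j)"
    by (simp add: X_def card_cartesian_product algebra_simps)
  moreover have "\<dots> \<le> Suc j * b (Suc j) * (fact j * (\<Prod>i=1..j. b i))"
    using Suc.IH by (intro mult_le_mono2) simp
  moreover have "\<dots> = fact (Suc j) * (\<Prod>i=1..Suc j. b i)"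
    by (simp add: prod.nat_ivl_Suc' algebra_simps)
  ultimately show ?case by linarith
qed

text \<open>Double counting the related pairs shows that some vertex hits at least the fraction
  \<open>b / card V\<close> of the elements still unhit. Each round adds such a vertex.\<close>

lemma greedy_hitting_set:
  fixes R :: "'a \<Rightarrow> 'b \<Rightarrow> bool"
  assumes fin: "finite V" "finite Y" and b: "\<And>y. y \<in> Y \<Longrightarrow> b \<le> card {x \<in> V. R x y}"
    and V: "V \<noteq> {}" "b \<le> card V"
  shows "\<exists>X \<subseteq> V. card X \<le> r \<and>
    real (card {y \<in> Y. \<forall>x \<in> X. \<not> R x y}) \<le> (1 - real b / real (card V)) ^ r * real (card Y)"
proof (induction r)
  case 0
  show ?case by (intro exI[of _ "{}"]) auto
next
  case (Suc r)
  then obtain X where X: "X \<subseteq> V" "card X \<le> r" and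
    IH: "real (card {y \<in> Y. \<forall>x \<in> X. \<not> R x y}) \<le> (1 - real b / real (card V)) ^ r * real (card Y)"
    by blast
  define U where "U = {y \<in> Y. \<forall>x \<in> X. \<not> R x y}"
  have finU: "finite U" using fin by (simp add: U_def)
  have n: "real (card V) > 0" using fin V by (simp add: card_gt_0_iff)
  have "card U * b = (\<Sum>y\<in>U. b)" by simp
  also have "\<dots> \<le> (\<Sum>y\<in>U. card {x \<in> V. R x y})" by (intro sum_mono b) (simp add: U_def)
  also have "\<dots> = (\<Sum>y\<in>U. \<Sum>x\<in>V. if R x y then 1 else 0)"
    using fin by (intro sum.cong) (auto simp: sum.If_cases Int_def)
  also have "\<dots> = (\<Sum>x\<in>V. \<Sum>y\<in>U. if R x y then 1 else 0)" by (rule sum.swap)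
  also have "\<dots> = (\<Sum>x\<in>V. card {y \<in> U. R x y})"
    using finU by (intro sum.cong) (auto simp: sum.If_cases Int_def)
  finally have sum: "card U * b \<le> (\<Sum>x\<in>V. card {y \<in> U. R x y})" .
  have "\<exists>x \<in> V. real (card U) * real b / real (card V) \<le> real (card {y \<in> U. R x y})"
  proof (rule ccontr)
    assume "\<not> ?thesis"
    then have "(\<Sum>x\<in>V. real (card {y \<in> U. R x y})) < (\<Sum>x\<in>V. real (card U) * real b / real (card V))"
      using fin V by (intro sum_strict_mono) auto
    also have "\<dots> = real (card U * b)" using n by simp
    finally show False using sum by (metis of_nat_le_iff of_nat_sum not_less)
  qed
  then obtain x where x: "x \<in> V" "real (card U) * real b / real (card V) \<le> real (card {y \<in> U. R x y})"
    by blast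
  have "{y \<in> Y. \<forall>x \<in> insert x X. \<not> R x y} = U - {y \<in> U. R x y}" by (auto simp: U_def)
  then have "real (card {y \<in> Y. \<forall>x \<in> insert x X. \<not> R x y}) = real (card U) - real (card {y \<in> U. R x y})"
    using finU by (simp add: card_Diff_subset card_mono of_nat_diff)
  also have "\<dots> \<le> (1 - real b / real (card V)) * real (card U)"
    using x(2) by (simp add: algebra_simps)
  also have "\<dots> \<le> (1 - real b / real (card V)) * ((1 - real b / real (card V)) ^ r * real (card Y))"
    using IH V(2) n unfolding U_def[symmetric] by (intro mult_left_mono) auto
  finally have "real (card {y \<in> Y. \<forall>x \<in> insert x X. \<not> R x y})
      \<le> (1 - real b / real (card V)) ^ Suc r * real (card Y)" by simp
  moreover have "card (insert x X) \<le> Suc r"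
    using X(2) by (metis card_insert_le_m1 card_insert_if Suc_le_mono finite_subset[OF X(1) fin(1)] le_SucI)
  ultimately show ?case using X(1) x(1) by (intro exI[of _ "insert x X"]) auto
qed

text \<open>Settling for half of \<open>Y\<close> keeps the hitting set at
  \<open>O(card V / b)\<close>; hitting everything greedily would bring in a logarithmic factor. The
  loss is only a factor 2 in the later count.\<close>

lemma half_hitting_set:
  fixes R :: "'a \<Rightarrow> 'b \<Rightarrow> bool"
  assumes fin: "finite V" "finite Y" and b: "\<And>y. y \<in> Y \<Longrightarrow> b \<le> card {x \<in> V. R x y}" "1 \<le> b"
  shows "\<exists>X \<subseteq> V. real (card X) \<le> 2 * real (card V) / real b \<and>
    card Y \<le> 2 * card {y \<in> Y. \<exists>x \<in> X. R x y}"
proof (cases "Y = {}")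
  case True
  then show ?thesis by (intro exI[of _ "{}"]) auto
next
  case False
  then obtain y where "y \<in> Y" by blast
  then have bV: "b \<le> card V" using b(1)[of y] card_mono[OF fin(1), of "{x \<in> V. R x y}"] by force
  then have V: "V \<noteq> {}" using b(2) by auto
  have b0: "real b > 0" and n0: "real (card V) > 0" using b(2) bV by auto
  define q where "q = real b / real (card V)"
  \<comment> \<open>This many rounds leave at most the fraction \<open>exp (- 1)\<close>, below one
    half. Rounding up at most doubles the number because \<open>b \<le> card V\<close>.\<close>
  define r where "r = nat \<lceil>real (card V) / real b\<rceil>"
  have one: "1 \<le> real (card V) / real b" using bV b0 by (simp add: field_simps)
  have r: "real (card V) / real b \<le> real r" "real r \<le> 2 * real (card V) / real b"
    using one unfolding r_def by linarith+
  have "1 / q \<le> real r" "q > 0" "q \<le> 1" using r(1) bV b0 n0 by (auto simp: q_def field_simps)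
  then have qr: "1 \<le> q * real r" by (simp add: field_simps)
  have "(1 - q) ^ r \<le> exp (- q) ^ r"
    using exp_ge_add_one_self[of "- q"] \<open>q \<le> 1\<close> by (intro power_mono) auto
  also have "\<dots> = exp (- (q * real r))" by (simp add: exp_of_nat_mult[symmetric] mult_ac)
  also have "\<dots> \<le> exp (- 1)" using qr by simp
  also have "\<dots> \<le> 1 / 2" using exp_ge_add_one_self[of 1] by (simp add: exp_minus field_simps)
  finally have half: "(1 - q) ^ r \<le> 1 / 2" .
  have "\<exists>X \<subseteq> V. card X \<le> r \<and>
      real (card {y \<in> Y. \<forall>x \<in> X. \<not> R x y}) \<le> (1 - q) ^ r * real (card Y)"
    unfolding q_def by (rule greedy_hitting_set[OF fin b(1) V bV])
  then obtain X where X: "X \<subseteq> V" "card X \<le> r"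
    "real (card {y \<in> Y. \<forall>x \<in> X. \<not> R x y}) \<le> (1 - q) ^ r * real (card Y)" by auto
  have "card Y = card {y \<in> Y. \<exists>x \<in> X. R x y} + card {y \<in> Y. \<forall>x \<in> X. \<not> R x y}"
    using fin by (subst card_Un_disjoint[symmetric]) (auto intro: arg_cong[of _ _ card])
  moreover have "(1 - q) ^ r * real (card Y) \<le> 1 / 2 * real (card Y)"
    using half by (intro mult_right_mono) auto
  ultimately have "card Y \<le> 2 * card {y \<in> Y. \<exists>x \<in> X. R x y}" using X(3) by linarith
  moreover have "real (card X) \<le> 2 * real (card V) / real b" using X(2) r(2) by linarith
  ultimately show ?thesis using X(1) by blast
qed

subsection \<open>Last arcs of shortest walks under faults\<close>

definition avoid :: "('a \<times> 'a) set \<Rightarrow> 'a set set \<Rightarrow> ('a \<times> 'a) set" where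
  "avoid A F = {a \<in> A. {fst a, snd a} \<notin> F}"

lemma avoid_subset: "avoid A F \<subseteq> A"
  by (auto simp: avoid_def)

lemma avoid_antimono: "F \<subseteq> F' \<Longrightarrow> avoid A F' \<subseteq> avoid A F"
  by (auto simp: avoid_def)

text \<open>Finiteness of \<open>F\<close> is explicit because \<open>card\<close> of an infinite
  set is 0.\<close>

definition last_arcs :: "('a \<times> 'a \<Rightarrow> int) \<Rightarrow> ('a \<times> 'a) set \<Rightarrow> nat \<Rightarrow> 'a \<Rightarrow> 'a set \<Rightarrow> ('a \<times> 'a) set" where
  "last_arcs w A k v S = {last p | p s F. s \<in> S \<and> finite F \<and> card F \<le> k \<and>
     sp w (avoid A F) s p v \<and> p \<noteq> []}"

lemma last_arcs_subset: "last_arcs w A k v S \<subseteq> A"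
proof
  fix a assume "a \<in> last_arcs w A k v S"
  then obtain p s F where "a = last p" "sp w (avoid A F) s p v" "p \<noteq> []"
    unfolding last_arcs_def by blast
  then have "walk (avoid A F) s p v" "a \<in> set p" using sp_walk by auto
  from walk_set[OF this(1)] this(2)
  show "a \<in> A" using avoid_subset[of A F] by auto
qed

lemma last_arcs_mono_sources: "x \<in> S \<Longrightarrow> last_arcs w A k v {x} \<subseteq> last_arcs w A k v S"
  unfolding last_arcs_def by blast

section \<open>Encoding faults by their positions on successive lightest walks\<close>

context unique_walks
begin

definition path :: "'a set set \<Rightarrow> 'a \<Rightarrow> 'a \<Rightarrow> ('a \<times> 'a) list" where
  "path F s v = (THE p. sp w (avoid A F) s p v)"

lemma path_eq: "sp w (avoid A F) s p v \<Longrightarrow> path F s v = p"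
  unfolding path_def by (rule the_equality, assumption, rule sp_unique[OF avoid_subset])

text \<open>Counting starts at the far end: \<open>D = 1\<close> is the arc entering
  \<open>v\<close>, so \<open>D\<close> measures how far from \<open>v\<close> the fault
  lies.\<close>

definition edge_at :: "'a \<Rightarrow> 'a \<Rightarrow> nat \<Rightarrow> 'a set set \<Rightarrow> 'a set" where
  "edge_at v s D F = (let a = path F s v ! (length (path F s v) - D) in {fst a, snd a})"

text \<open>A list of positions encodes, from right to left, a sequence of faults each of which lies on the
  shortest walk avoiding the previous ones.\<close>

primrec faults :: "'a \<Rightarrow> 'a \<Rightarrow> nat list \<Rightarrow> 'a set set" where
  "faults v s [] = {}"
| "faults v s (D # Ds) = insert (edge_at v s D (faults v s Ds)) (faults v s Ds)"

text \<open>Each fault is still located with all earlier faults deleted, far ones included. This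
  selects a subset of \<open>faults v s Ds\<close>; decoding the filtered list could give other
  edges.\<close>

primrec near_faults :: "nat \<Rightarrow> 'a \<Rightarrow> 'a \<Rightarrow> nat list \<Rightarrow> 'a set set" where
  "near_faults b v s [] = {}"
| "near_faults b v s (D # Ds) =
     (if D \<le> b then insert (edge_at v s D (faults v s Ds)) (near_faults b v s Ds)
      else near_faults b v s Ds)"

text \<open>The \<open>sp\<close> clause guarantees that the description in \<open>path\<close>
  denotes an actual walk; the bounds on \<open>D\<close> keep the index of \<open>edge_at\<close> in
  range.\<close>

primrec valid :: "'a \<Rightarrow> 'a \<Rightarrow> nat list \<Rightarrow> bool" where
  "valid v s [] \<longleftrightarrow> True"
| "valid v s (D # Ds) \<longleftrightarrow> valid v s Ds \<and>
     sp w (avoid A (faults v s Ds)) s (path (faults v s Ds) s v) v \<and>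
     1 \<le> D \<and> D \<le> length (path (faults v s Ds) s v)"

lemma near_faults_subset: "near_faults b v s Ds \<subseteq> faults v s Ds"
  by (induction Ds) auto

lemma card_near_faults:
  "finite (near_faults b v s Ds) \<and> card (near_faults b v s Ds) \<le> length (filter (\<lambda>D. D \<le> b) Ds)"
  by (induction Ds) (auto simp: card_insert_if)

lemma sp_avoid_exists:
  assumes "walk (avoid A F) s q v"
  shows "sp w (avoid A F) s (path F s v) v"
proof -
  obtain p where "sp w (avoid A F) s p v"
    using sp_exists[OF assms, of w] pos by (auto simp: avoid_def)
  then show ?thesis using path_eq by simp
qed

text \<open>As long as the lightest walk avoiding the recorded faults meets \<open>F\<close>, record
  one such edge. Each is a new element of \<open>F\<close>, so this stops within
  \<open>card F\<close> rounds. The walk then avoids \<open>F\<close>, is lightest there too, and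
  equals \<open>p\<close> by uniqueness.\<close>

lemma exists_fault_sequence:
  assumes F: "finite F" and p: "sp w (avoid A F) s p v"
  shows "\<exists>Ds. length Ds \<le> card F \<and> valid v s Ds \<and> sp w (avoid A (faults v s Ds)) s p v"
proof -
  have "\<exists>Ds. length Ds \<le> card F \<and> valid v s Ds \<and> sp w (avoid A (faults v s Ds)) s p v"
    if "valid v s Es" "faults v s Es \<subseteq> F" "card (faults v s Es) = length Es"
      "card F - length Es = m" for m Es
    using that
  proof (induction m arbitrary: Es rule: less_induct)
    case (less m)
    define q where "q = path (faults v s Es) s v"
    have q: "sp w (avoid A (faults v s Es)) s q v"
      unfolding q_def
      using sp_avoid_exists walk_mono[OF sp_walk[OF p] avoid_antimono[OF less.prems(2)]] by simp
    have lenEs: "length Es \<le> card F" using less.prems(2,3) card_mono[OF F] by metis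
    show ?case
    proof (cases "set q \<subseteq> avoid A F")
      case True
      have "sp w (avoid A F) s q v"
        using sp_subset[OF q avoid_antimono[OF less.prems(2)] True] .
      then have "q = p" using sp_unique[OF avoid_subset _ p] by simp
      then show ?thesis using q less.prems lenEs by blast
    next
      case False
      then obtain i where i: "i < length q" "q ! i \<notin> avoid A F"
        by (metis in_set_conv_nth subsetI)
      define D where "D = length q - i"
      have qi: "q ! i \<in> avoid A (faults v s Es)" using walk_set[OF sp_walk[OF q]] i(1) by auto
      have e: "edge_at v s D (faults v s Es) = {fst (q ! i), snd (q ! i)}"
        using i(1) by (simp add: edge_at_def D_def Let_def q_def[symmetric])
      have eF: "edge_at v s D (faults v s Es) \<in> F - faults v s Es"
        using qi i(2) unfolding e avoid_def by auto
      have valid: "valid v s (D # Es)"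
        using less.prems(1) q i(1) by (simp add: q_def[symmetric] D_def)
      have sub: "faults v s (D # Es) \<subseteq> F" using eF less.prems(2) by simp
      have card: "card (faults v s (D # Es)) = length (D # Es)"
        using eF less.prems(2,3) finite_subset[OF less.prems(2) F] by simp
      have "length (D # Es) \<le> card F" using card sub card_mono[OF F] by metis
      then have "card F - length (D # Es) < m" using less.prems(4) by simp
      from less.IH[OF this valid sub card refl] show ?thesis .
    qed
  qed
  from this[of "[]"] show ?thesis by simp
qed

text \<open>Suppose a fault at position \<open>D > b\<close> lies on \<open>q\<close>. With the
  earlier faults deleted, both of its ends are at least \<open>D - 1\<close> arcs away from
  \<open>v\<close>, so \<open>q\<close>, which also traverses the fault, would have at least
  \<open>D\<close> arcs.\<close>

lemma short_walk_avoids_faults: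
  assumes "valid v s Ds" "walk (avoid A (near_faults b v s Ds)) x q v" "length q \<le> b"
  shows "set q \<subseteq> avoid A (faults v s Ds)"
  using assms
proof (induction Ds)
  case Nil
  then show ?case using walk_set by fastforce
next
  case (Cons D Ds)
  let ?F = "faults v s Ds" and ?e = "edge_at v s D (faults v s Ds)"
  have "near_faults b v s Ds \<subseteq> near_faults b v s (D # Ds)" by auto
  from walk_mono[OF Cons.prems(2) avoid_antimono[OF this]]
  have IH: "set q \<subseteq> avoid A ?F" using Cons.IH Cons.prems by simp
  have "?e \<noteq> {fst a, snd a}" if a: "a \<in> set q" for a
  proof (cases "D \<le> b")
    case True
    then show ?thesis using walk_set[OF Cons.prems(2)] a by (auto simp: avoid_def)
  next
    case False
    show ?thesis
    proof
      assume e: "?e = {fst a, snd a}"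
      define P where "P = path ?F s v"
      define i where "i = length P - D"
      have P: "sp w (avoid A ?F) s P v" and D: "1 \<le> D" "D \<le> length P"
        using Cons.prems(1) by (auto simp: P_def)
      have i: "i < length P" using D by (simp add: i_def)
      obtain c d where cd: "P ! i = (c, d)" by (cases "P ! i")
      have e': "?e = {c, d}" using cd by (simp add: edge_at_def P_def i_def)
      define P1 P2 where "P1 = take i P" and "P2 = drop (Suc i) P"
      have Peq: "P = P1 @ (c, d) # P2" unfolding P1_def P2_def cd[symmetric]
        using i by (simp add: id_take_nth_drop)
      have len2: "Suc (length P2) = D" using D by (simp add: P2_def i_def)
      have w1: "walk (avoid A ?F) s P1 c" and w2: "walk (avoid A ?F) d P2 v"
        and w3: "walk (avoid A ?F) c ((c, d) # P2) v"
        using sp_walk[OF P] unfolding Peq by (auto simp: walk_append)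
      have s3: "sp w (avoid A ?F) c ((c, d) # P2) v"
        using sp_appendD(2)[of w "avoid A ?F" s P1 "(c, d) # P2" v c] P[unfolded Peq] w1 w3 by simp
      have "sp w (avoid A ?F) d P2 v"
        using sp_appendD(2)[of w "avoid A ?F" c "[(c, d)]" P2 v d] s3 w2 w3 by simp
      note len = sp_length_le[OF avoid_subset this] sp_length_le[OF avoid_subset s3]
      have wq: "walk (avoid A ?F) x q v" using walk_restrict[OF Cons.prems(2) IH] .
      obtain q1 q2 where q: "q = q1 @ a # q2" using split_list[OF a] by blast
      then have q2: "walk (avoid A ?F) (snd a) q2 v" using wq by (auto simp: walk_append)
      have "{fst a, snd a} = {c, d}" using e e' by simp
      then have "snd a = d \<or> snd a = c" by (auto simp: doubleton_eq_iff)
      then have "length P2 \<le> length q2" using len(1)[of q2] len(2)[of q2] q2 by fastforce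
      then show False using q len2 False Cons.prems(3) by simp
    qed
  qed
  then show ?case using IH unfolding avoid_def by fastforce
qed

text \<open>Deleting more edges cannot shorten the distance to \<open>v\<close>, and each position
  is bounded by the length of the walk it was recorded on.\<close>

lemma position_le_length:
  assumes "valid v s Ds" "walk (avoid A (faults v s Ds)) s p v" "D \<in> set Ds"
  shows "D \<le> length p"
  using assms
proof (induction Ds)
  case (Cons E Ds)
  have wk: "walk (avoid A (faults v s Ds)) s p v"
    using walk_mono[OF Cons.prems(2) avoid_antimono[of "faults v s Ds"]] by auto
  have "E \<le> length p"
    using Cons.prems(1) sp_length_le[OF avoid_subset _ wk] by fastforce
  then show ?case using Cons.IH Cons.prems wk by auto
qed simp

text \<open>Faults further than \<open>b\<close> from \<open>v\<close> are irrelevant for the walks from the last \<open>b\<close> vertices.\<close>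

lemma many_sources:
  assumes valid: "valid v s Ds" and p: "sp w (avoid A (faults v s Ds)) s p v"
    and i: "1 \<le> i" "i \<le> length (filter (\<lambda>D. b < D) Ds)" and k: "length Ds \<le> k"
  shows "b \<le> card {x \<in> V. last p \<in> last_arcs w A (k - i) v {x}}"
proof -
  let ?F = "faults v s Ds" and ?N = "near_faults b v s Ds"
  have wp: "walk (avoid A ?F) s p v" by (rule sp_walk[OF p])
  have "filter (\<lambda>D. b < D) Ds \<noteq> []" using i by auto
  then obtain D where "D \<in> set Ds" "b < D" by (auto simp: filter_empty_conv)
  then have bp: "b \<le> length p" using position_le_length[OF valid wp] by fastforce
  have "length (filter (\<lambda>D. b < D) Ds) + length (filter (\<lambda>D. D \<le> b) Ds) = length Ds"
    using sum_length_filter_compl[of "\<lambda>D. b < D" Ds] by (simp add: not_less)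
  then have N: "finite ?N" "card ?N \<le> k - i"
    using card_near_faults[of b v s Ds] i(2) k by linarith+
  have "distinct (map fst p)"
    using sp_distinct[OF p] pos avoid_subset by (metis distinct_append subsetD)
  then have dist: "distinct (map fst (drop (length p - b) p))" by (simp add: drop_map[symmetric])
  \<comment> \<open>These are the tails of the last \<open>b\<close> arcs, pairwise different since
    \<open>p\<close> is simple.\<close>
  define X where "X = set (map fst (drop (length p - b) p))"
  have "card X = b" unfolding X_def using distinct_card[OF dist] bp by simp
  moreover have "X \<subseteq> {x \<in> V. last p \<in> last_arcs w A (k - i) v {x}}"
  proof
    fix x assume x: "x \<in> X"
    have "walk (avoid A ?F) s (take (length p - b) p @ drop (length p - b) p) v" using wp by simp
    then obtain y where y: "walk (avoid A ?F) y (drop (length p - b) p) v"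
      unfolding walk_append by blast
    from walk_split_at[OF y x[unfolded X_def]] obtain r1 r2 where
      r: "drop (length p - b) p = r1 @ r2" "walk (avoid A ?F) y r1 x" "walk (avoid A ?F) x r2 v" "r2 \<noteq> []"
      by blast
    have pr: "p = (take (length p - b) p @ r1) @ r2" using r(1) by (metis append.assoc append_take_drop_id)
    have "\<exists>z. walk (avoid A ?F) s (take (length p - b) p @ r1) z \<and> walk (avoid A ?F) z r2 v"
      using wp by (subst (asm) pr) (simp only: walk_append)
    moreover have "z = x" if "walk (avoid A ?F) z r2 v" for z
      using that r(3,4) by (cases r2) auto
    ultimately have "walk (avoid A ?F) s (take (length p - b) p @ r1) x" by blast
    then have sr: "sp w (avoid A ?F) x r2 v"
      using sp_appendD(2)[of w "avoid A ?F" s "take (length p - b) p @ r1" r2 v x] p pr r(3) by simp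
    have "length r2 \<le> length (drop (length p - b) p)" using r(1) by simp
    then have len: "length r2 \<le> b" using bp by simp
    have wr: "walk (avoid A ?N) x r2 v"
      using walk_mono[OF r(3) avoid_antimono[OF near_faults_subset]] .
    \<comment> \<open>With only the near faults deleted, the lightest walk from \<open>x\<close> is
      still short, hence avoids the far faults as well and must be \<open>r2\<close>. The last arc
      of \<open>p\<close> thus arises from \<open>x\<close> with at most \<open>k - i\<close>
      faults.\<close>
    define q where "q = path ?N x v"
    have q: "sp w (avoid A ?N) x q v" unfolding q_def by (rule sp_avoid_exists[OF wr])
    have "length q \<le> b" using sp_length_le[OF avoid_subset q wr] len by simp
    then have "set q \<subseteq> avoid A ?F" using short_walk_avoids_faults[OF valid sp_walk[OF q]] by simp
    then have "sp w (avoid A ?F) x q v"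
      using sp_subset[OF q avoid_antimono[OF near_faults_subset]] by simp
    then have "q = r2" using sp_unique[OF avoid_subset _ sr] by simp
    moreover have "last p = last r2" by (subst pr) (use r(4) in simp)
    ultimately have "last p \<in> last_arcs w A (k - i) v {x}"
      unfolding last_arcs_def using q N r(4) by (auto intro!: exI[of _ r2] exI[of _ ?N])
    moreover have "x \<in> V"
    proof -
      have "fst ` set p \<subseteq> V" using walk_set[OF wp] avoid_subset[of A ?F] arcs_subset by fastforce
      then show ?thesis using x unfolding X_def by (auto dest: in_set_dropD)
    qed
    ultimately show "x \<in> {x \<in> V. last p \<in> last_arcs w A (k - i) v {x}}" by simp
  qed
  ultimately show ?thesis using finite_V card_mono[of "{x \<in> V. last p \<in> last_arcs w A (k - i) v {x}}" X] by simp
qed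

text \<open>Positions within the thresholds \<open>b\<close> are decoded from the source and the
  list. Otherwise, for some \<open>i\<close>, at least \<open>i\<close> positions exceed
  \<open>b i\<close>, and \<open>many_sources\<close> applies. The thresholds stay free here and are
  chosen when counting.\<close>

lemma last_arcs_cases:
  "last_arcs w A k v S \<subseteq>
     (\<lambda>(s, Ds). last (path (faults v s Ds) s v)) ` (S \<times> (\<Union>j\<le>k. dominated b j)) \<union>
     (\<Union>i\<in>{1..k}. {a \<in> A. b i \<le> card {x \<in> V. a \<in> last_arcs w A (k - i) v {x}}})"
proof
  fix a assume a: "a \<in> last_arcs w A k v S"
  then obtain p s F where pF: "a = last p" "s \<in> S" "finite F" "card F \<le> k" "sp w (avoid A F) s p v"
    unfolding last_arcs_def by blast
  from exists_fault_sequence[OF pF(3,5)] obtain Ds where Ds: "length Ds \<le> card F" "valid v s Ds"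
    "sp w (avoid A (faults v s Ds)) s p v" by blast
  have "1 \<le> D" if "D \<in> set Ds" for D
    using Ds(2) that by (induction Ds) auto
  show "a \<in> (\<lambda>(s, Ds). last (path (faults v s Ds) s v)) ` (S \<times> (\<Union>j\<le>k. dominated b j)) \<union>
     (\<Union>i\<in>{1..k}. {a \<in> A. b i \<le> card {x \<in> V. a \<in> last_arcs w A (k - i) v {x}}})"
  proof (cases "Ds \<in> dominated b (length Ds)")
    case True
    then have "(s, Ds) \<in> S \<times> (\<Union>j\<le>k. dominated b j)" using pF Ds(1) by auto
    moreover have "a = (\<lambda>(s, Ds). last (path (faults v s Ds) s v)) (s, Ds)"
      using path_eq[OF Ds(3)] pF(1) by simp
    ultimately show ?thesis by blast
  next
    case False
    then obtain i where i: "i \<in> {1..length Ds}" "i \<le> length (filter (\<lambda>D. b i < D) Ds)"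
      using \<open>\<And>D. D \<in> set Ds \<Longrightarrow> 1 \<le> D\<close> unfolding dominated_def by (auto simp: not_less)
    have "b i \<le> card {x \<in> V. last p \<in> last_arcs w A (k - i) v {x}}"
      using many_sources[OF Ds(2,3) _ i(2), of k] i(1) Ds(1) pF(4) by simp
    then show ?thesis using i(1) Ds(1) pF(1,4) a last_arcs_subset[of w A k v S] by auto
  qed
qed

end

subsection \<open>The bound on the number of last arcs\<close>

lemma prod_powr_halving: "0 < x \<Longrightarrow> (\<Prod>i=1..j. x powr (1 / 2 ^ i)) \<le> x powr (1 - 1 / 2 ^ j)" for x :: real
proof (induction j)
  case 0
  then show ?case by simp
next
  case (Suc j)
  have "(\<Prod>i=1..Suc j. x powr (1 / 2 ^ i)) \<le> x powr (1 - 1 / 2 ^ j) * x powr (1 / 2 ^ Suc j)"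
    using Suc by (simp add: mult_right_mono)
  also have "\<dots> = x powr (1 - 1 / 2 ^ Suc j)"
    by (simp add: powr_add[symmetric] field_simps)
  finally show ?case .
qed

text \<open>The threshold for the position of the \<open>i\<close>-th furthest fault is \<open>(n / m)\<close> to the power
  \<open>1 / 2 ^ i\<close>, with \<open>m\<close> the number of sources. If \<open>i\<close> of the positions exceed it, then these faults may
  be dropped when the sources are replaced by \<open>O(n (m / n) ^ (1 / 2 ^ i))\<close> hitting vertices.\<close>

lemma card_last_arcs_step:
  fixes k :: nat and C :: "nat \<Rightarrow> real"
  assumes "unique_walks V A w M" and S: "S \<subseteq> V" "S \<noteq> {}"
    and C0: "\<And>j. C j \<ge> 0"
    and IH: "\<And>j S. j < k \<Longrightarrow> S \<subseteq> V \<Longrightarrow>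
      real (card (last_arcs w A j v S))
        \<le> C j * real (card V) powr (1 - 1 / 2 ^ j) * real (card S) powr (1 / 2 ^ j)"
  shows "real (card (last_arcs w A k v S))
    \<le> ((\<Sum>j\<le>k. fact j * 2 ^ j) + (\<Sum>i\<in>{1..k}. 4 * C (k - i))) *
       real (card V) powr (1 - 1 / 2 ^ k) * real (card S) powr (1 / 2 ^ k)"
proof -
  interpret unique_walks V A w M by fact
  have finS: "finite S" using S finite_V finite_subset by blast
  have finA: "finite A" using arcs_subset finite_V finite_subset by blast
  define n where "n = real (card V)"
  define m where "m = real (card S)"
  define N where "N = n / m"
  have m: "1 \<le> m" using S finS by (simp add: m_def Suc_le_eq card_gt_0_iff)
  have mn: "m \<le> n" unfolding m_def n_def using S finite_V by (simp add: card_mono)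
  have N: "1 \<le> N" using m mn by (simp add: N_def)
  \<comment> \<open>The target bound without its constant, in the form in which both cases produce
    it.\<close>
  define T where "T = n * N powr (- (1 / 2 ^ k))"
  have T: "T = n powr (1 - 1 / 2 ^ k) * m powr (1 / 2 ^ k)"
    using m mn powr_add[of n 1 "- (1 / 2 ^ k)"]
    by (simp add: T_def N_def powr_divide powr_minus[of m] divide_simps)
  have T0: "T \<ge> 0" using m mn by (simp add: T_def)
  \<comment> \<open>Rounding up at most doubles the threshold since \<open>N \<ge> 1\<close>; this
    is the origin of the factor \<open>2 ^ j\<close>.\<close>
  define b where "b i = nat \<lceil>N powr (1 / 2 ^ i)\<rceil>" for i :: nat
  have one: "1 \<le> N powr (1 / 2 ^ i)" for i :: nat using N by (simp add: ge_one_powr_ge_zero)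
  have b: "N powr (1 / 2 ^ i) \<le> real (b i)" "real (b i) \<le> 2 * N powr (1 / 2 ^ i)" "1 \<le> b i" for i
    using one[of i] unfolding b_def by linarith+
  define near where "near = (\<lambda>(s, Ds). last (path (faults v s Ds) s v)) ` (S \<times> (\<Union>j\<le>k. dominated b j))"
  define far where "far i = {a \<in> A. b i \<le> card {x \<in> V. a \<in> last_arcs w A (k - i) v {x}}}" for i
  have fin_dom: "finite (dominated b j)" for j using card_dominated by blast
  have near_bound: "real (card near) \<le> (\<Sum>j\<le>k. fact j * 2 ^ j) * T"
  proof -
    have dom: "real (card (dominated b j)) \<le> fact j * 2 ^ j * N powr (1 - 1 / 2 ^ k)" if "j \<le> k" for j
    proof -
      have "real (card (dominated b j)) \<le> real (fact j * (\<Prod>i=1..j. b i))"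
        using card_dominated[of b j] by (simp only: of_nat_le_iff)
      also have "\<dots> = fact j * (\<Prod>i=1..j. real (b i))" by simp
      also have "\<dots> \<le> fact j * (\<Prod>i=1..j. 2 * N powr (1 / 2 ^ i))"
        using b(2) by (intro mult_left_mono prod_mono) auto
      also have "\<dots> = fact j * 2 ^ j * (\<Prod>i=1..j. N powr (1 / 2 ^ i))"
        by (simp add: prod.distrib)
      also have "\<dots> \<le> fact j * 2 ^ j * N powr (1 - 1 / 2 ^ j)"
        using N by (intro mult_left_mono prod_powr_halving) auto
      also have "\<dots> \<le> fact j * 2 ^ j * N powr (1 - 1 / 2 ^ k)"
        using N that by (intro mult_left_mono powr_mono) (auto simp: field_simps power_increasing)
      finally show ?thesis .
    qed
    have "card near \<le> card S * card (\<Union>j\<le>k. dominated b j)"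
      unfolding near_def using finS fin_dom
      by (intro card_image_le[THEN order_trans]) (auto simp: card_cartesian_product)
    also have "\<dots> \<le> card S * (\<Sum>j\<le>k. card (dominated b j))"
      by (intro mult_le_mono2 card_UN_le) simp
    finally have "real (card near) \<le> real (card S * (\<Sum>j\<le>k. card (dominated b j)))"
      by (simp only: of_nat_le_iff)
    also have "\<dots> = m * (\<Sum>j\<le>k. real (card (dominated b j)))" by (simp add: m_def)
    also have "\<dots> \<le> m * (\<Sum>j\<le>k. fact j * 2 ^ j * N powr (1 - 1 / 2 ^ k))"
      using m dom by (intro mult_left_mono sum_mono) auto
    also have "\<dots> = (\<Sum>j\<le>k. fact j * 2 ^ j) * (m * N powr (1 - 1 / 2 ^ k))"
      unfolding sum_distrib_right[symmetric] by (rule mult.left_commute)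
    \<comment> \<open>Here \<open>m * N = n\<close> is used.\<close>
    also have "m * N powr (1 - 1 / 2 ^ k) = T"
      using m N powr_add[of N 1 "- (1 / 2 ^ k)"] by (simp add: T_def N_def)
    finally show ?thesis .
  qed
  have far_bound: "real (card (far i)) \<le> 4 * C (k - i) * T" if i: "i \<in> {1..k}" for i
  proof -
    \<comment> \<open>The exponent of the source count in the induction hypothesis. Since
      \<open>1 / 2 ^ i * e = 1 / 2 ^ k\<close>, the saving in the size of \<open>X\<close> becomes
      exactly that in \<open>T\<close>. The constant 4 combines the halving of \<open>far i\<close>
      with \<open>2 powr e \<le> 2\<close>.\<close>
    define e where "e = (1 / 2 ^ (k - i) :: real)"
    have e: "0 < e" "e \<le> 1" by (auto simp: e_def)
    have "2 ^ i * 2 ^ (k - i) = (2 ^ k :: real)" using i by (simp add: power_add[symmetric])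
    then have ei: "1 / 2 ^ i * e = 1 / (2 ^ k :: real)" by (simp add: e_def)
    have "far i \<subseteq> A" by (auto simp: far_def)
    then have fin_far: "finite (far i)" using finA finite_subset by blast
    have "\<exists>X \<subseteq> V. real (card X) \<le> 2 * real (card V) / real (b i) \<and>
        card (far i) \<le> 2 * card {a \<in> far i. \<exists>x \<in> X. a \<in> last_arcs w A (k - i) v {x}}"
      using half_hitting_set[OF finite_V fin_far, of "b i" "\<lambda>x a. a \<in> last_arcs w A (k - i) v {x}"] b(3)
      by (simp add: far_def)
    then obtain X where X: "X \<subseteq> V" "real (card X) \<le> 2 * n / real (b i)"
      "card (far i) \<le> 2 * card {a \<in> far i. \<exists>x \<in> X. a \<in> last_arcs w A (k - i) v {x}}"
      unfolding n_def by auto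
    have "{a \<in> far i. \<exists>x \<in> X. a \<in> last_arcs w A (k - i) v {x}} \<subseteq> last_arcs w A (k - i) v X"
      using last_arcs_mono_sources by fastforce
    then have "card {a \<in> far i. \<exists>x \<in> X. a \<in> last_arcs w A (k - i) v {x}}
        \<le> card (last_arcs w A (k - i) v X)"
      by (intro card_mono finite_subset[OF last_arcs_subset finA])
    then have le: "real (card (far i)) \<le> 2 * real (card (last_arcs w A (k - i) v X))"
      using X(3) by linarith
    have "real (card X) \<le> 2 * n / N powr (1 / 2 ^ i)"
      using X(2) b(1)[of i] one[of i] m mn
      by (elim order_trans) (intro divide_left_mono, auto intro!: mult_pos_pos)
    then have "real (card X) \<le> 2 * (n * N powr (- (1 / 2 ^ i)))"
      by (simp add: powr_minus divide_simps)
    then have "real (card X) powr e \<le> (2 * (n * N powr (- (1 / 2 ^ i)))) powr e"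
      using e by (intro powr_mono2) auto
    also have "\<dots> = 2 powr e * (n powr e * N powr (- (1 / 2 ^ k)))"
      using m mn ei by (simp add: powr_mult powr_powr)
    also have "\<dots> \<le> 2 * (n powr e * N powr (- (1 / 2 ^ k)))"
      using e powr_mono[of e 1 2] by (intro mult_right_mono) auto
    finally have Xe: "real (card X) powr e \<le> 2 * (n powr e * N powr (- (1 / 2 ^ k)))" .
    have "real (card (last_arcs w A (k - i) v X)) \<le> C (k - i) * n powr (1 - e) * real (card X) powr e"
      using IH[of "k - i" X] X(1) i unfolding n_def e_def by auto
    also have "\<dots> \<le> C (k - i) * n powr (1 - e) * (2 * (n powr e * N powr (- (1 / 2 ^ k))))"
      using Xe C0[of "k - i"] by (intro mult_left_mono) auto
    also have "\<dots> = 2 * C (k - i) * (n powr (1 - e) * n powr e) * N powr (- (1 / 2 ^ k))" by simp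
    also have "\<dots> = 2 * C (k - i) * T"
      using m mn by (simp add: powr_add[symmetric] T_def)
    finally show ?thesis using le by linarith
  qed
  have "finite near" unfolding near_def using finS fin_dom by auto
  then have fin: "finite (near \<union> (\<Union>i\<in>{1..k}. far i))"
    using finA by (auto simp: far_def)
  have "card (last_arcs w A k v S) \<le> card (near \<union> (\<Union>i\<in>{1..k}. far i))"
    using last_arcs_cases[of k v S b] unfolding near_def[symmetric] far_def[symmetric]
    by (intro card_mono fin)
  also have "\<dots> \<le> card near + (\<Sum>i\<in>{1..k}. card (far i))"
    by (intro card_Un_le[THEN order_trans] add_left_mono card_UN_le) simp
  finally have "real (card (last_arcs w A k v S)) \<le> real (card near) + (\<Sum>i\<in>{1..k}. real (card (far i)))"
    by (simp only: of_nat_le_iff of_nat_add[symmetric] of_nat_sum[symmetric])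
  also have "\<dots> \<le> (\<Sum>j\<le>k. fact j * 2 ^ j) * T + (\<Sum>i\<in>{1..k}. 4 * C (k - i) * T)"
    using near_bound far_bound by (intro add_mono sum_mono) auto
  also have "\<dots> = ((\<Sum>j\<le>k. fact j * 2 ^ j) + (\<Sum>i\<in>{1..k}. 4 * C (k - i))) * T"
    by (simp add: sum_distrib_right distrib_right)
  finally show ?thesis unfolding T n_def m_def by (simp add: mult.assoc)
qed

text \<open>The recurrence is that of \<open>card_last_arcs_step\<close>, so the constant depends on
  the number of faults alone.\<close>

fun arcs_const :: "nat \<Rightarrow> real" where
  "arcs_const k = (\<Sum>j\<le>k. fact j * 2 ^ j) + (\<Sum>i\<in>{1..k}. 4 * arcs_const (k - i))"

declare arcs_const.simps [simp del]

lemma arcs_const_nonneg: "arcs_const k \<ge> 0"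
proof (induction k rule: less_induct)
  case (less k)
  then show ?case by (subst arcs_const.simps) (intro add_nonneg_nonneg sum_nonneg, auto)
qed

lemma card_last_arcs:
  assumes "unique_walks V A w M" "S \<subseteq> V"
  shows "real (card (last_arcs w A k v S))
    \<le> arcs_const k * real (card V) powr (1 - 1 / 2 ^ k) * real (card S) powr (1 / 2 ^ k)"
  using assms(2)
proof (induction k arbitrary: S rule: less_induct)
  case (less k)
  show ?case
  proof (cases "S = {}")
    case True
    then show ?thesis by (simp add: last_arcs_def)
  next
    case False
    show ?thesis
      using card_last_arcs_step[OF assms(1) less.prems False arcs_const_nonneg less.IH]
      by (subst arcs_const.simps) blast
  qed
qed

subsection \<open>The preserver\<close>

lemma sym_avoid: "sym A \<Longrightarrow> sym (avoid A F)"
  by (auto simp: sym_def avoid_def insert_commute)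

text \<open>An \<open>awalk\<close> must start at a vertex of the graph, which \<open>walk\<close>
  does not check for the empty list; hence the hypothesis on \<open>s\<close>.\<close>

lemma gdist_del_uedges:
  assumes "pair_graph G" "s \<in> pverts G"
  shows "gdist (del_uedges G F) s t =
    (INF p \<in> {p. walk (avoid (parcs G) F) s p t}. ereal (real (length p)))"
proof -
  let ?D = "del_uedges G F"
  interpret D: pair_graph ?D by (rule pair_graph_del_uedges[OF assms(1)])
  have arcs: "parcs ?D = avoid (parcs G) F" by (auto simp: del_uedges_def avoid_def)
  have verts: "s \<in> pverts ?D" using assms(2) by (simp add: del_uedges_def)
  have cas: "D.cas x p t \<and> set p \<subseteq> parcs ?D \<longleftrightarrow> walk (avoid (parcs G) F) x p t" for x p
    by (induction p arbitrary: x) (auto simp: arcs)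
  have "D.awalk s p t \<longleftrightarrow> walk (avoid (parcs G) F) s p t" for p
    using cas[of s p] verts by (auto simp: D.awalk_def)
  then show ?thesis using gdist_eq_INF_length[OF pair_graph_del_uedges[OF assms(1)]] by simp
qed

lemma ft_dist_preserverI:
  assumes G: "pair_graph G" and H: "pair_graph H" "pverts H = pverts G" "parcs H \<subseteq> parcs G"
    and ST: "S \<subseteq> pverts G"
    and walks: "\<And>s t F P. s \<in> S \<Longrightarrow> t \<in> T \<Longrightarrow> F \<subseteq> uedges G \<Longrightarrow> card F \<le> k \<Longrightarrow>
      walk (avoid (parcs G) F) s P t \<Longrightarrow>
      \<exists>Q. walk (avoid (parcs H) F) s Q t \<and> length Q \<le> length P"
  shows "ft_dist_preserver k S T G H"
proof -
  interpret G: pair_graph G by fact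
  interpret H: pair_graph H by fact
  have "subgraph (with_proj H) (with_proj G)"
    using H(2,3) G.wf_digraph_axioms H.wf_digraph_axioms
    by (auto simp: subgraph_def compatible_def)
  moreover have "gdist (del_uedges H F) s t = gdist (del_uedges G F) s t"
    if "s \<in> S" "t \<in> T" "F \<subseteq> uedges G" "card F \<le> k" for s t F
  proof (rule antisym)
    have s: "s \<in> pverts G" "s \<in> pverts H" using that ST H(2) by auto
    show "gdist (del_uedges H F) s t \<le> gdist (del_uedges G F) s t"
      unfolding gdist_del_uedges[OF G s(1)] gdist_del_uedges[OF H(1) s(2)]
      by (intro INF_mono) (use walks[OF that] in auto)
    have "avoid (parcs H) F \<subseteq> avoid (parcs G) F" using H(3) by (auto simp: avoid_def)
    then show "gdist (del_uedges G F) s t \<le> gdist (del_uedges H F) s t"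
      unfolding gdist_del_uedges[OF G s(1)] gdist_del_uedges[OF H(1) s(2)]
      by (intro INF_superset_mono) (auto intro: walk_mono)
  qed
  ultimately show ?thesis using H(1) by (simp add: ft_dist_preserver_def)
qed

section \<open>The union of the lightest walks from the sources\<close>

context unique_walks
begin

text \<open>The end \<open>v\<close> is unrestricted because restoration joins two walks at an
  arbitrary vertex.\<close>

definition preserver_arcs :: "nat \<Rightarrow> 'a set \<Rightarrow> ('a \<times> 'a) set" where
  "preserver_arcs k S = {a. \<exists>s \<in> S. \<exists>v F p. finite F \<and> card F \<le> k \<and>
     sp w (avoid A F) s p v \<and> a \<in> set p}"

text \<open>A prefix of a lightest walk is lightest, so every arc of it is the last arc of a
  lightest walk to its own head.\<close>

lemma preserver_arcs_last:
  "preserver_arcs k S \<subseteq> (\<Union>v\<in>V. last_arcs w A k v S)"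
proof
  fix a assume "a \<in> preserver_arcs k S"
  then obtain s v F p where *: "s \<in> S" "finite F" "card F \<le> k" "sp w (avoid A F) s p v" "a \<in> set p"
    unfolding preserver_arcs_def by blast
  obtain p1 p2 where p: "p = p1 @ a # p2" using split_list[OF *(5)] by blast
  have wk: "walk (avoid A F) s (p1 @ [a]) (snd a)" "walk (avoid A F) (snd a) p2 v"
    using sp_walk[OF *(4)] by (auto simp: p walk_append)
  have "sp w (avoid A F) s (p1 @ [a]) (snd a)"
    using sp_appendD(1)[OF _ wk] *(4) by (simp add: p)
  then have "a \<in> last_arcs w A k (snd a) S"
    unfolding last_arcs_def using *(1-3) by (auto intro!: exI[of _ "p1 @ [a]"])
  moreover have "snd a \<in> V"
    using last_arcs_subset[of w A k "snd a" S] calculation arcs_subset by auto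
  ultimately show "a \<in> (\<Union>v\<in>V. last_arcs w A k v S)" by blast
qed

lemma preserver_arcs_subset: "preserver_arcs k S \<subseteq> A"
  using preserver_arcs_last[of k S] last_arcs_subset[of w A k _ S] by auto

lemma card_preserver_arcs:
  assumes "S \<subseteq> V"
  shows "real (card (preserver_arcs k S))
    \<le> arcs_const k * real (card V) powr (2 - 1 / 2 ^ k) * real (card S) powr (1 / 2 ^ k)"
proof -
  define c where "c = arcs_const k * real (card V) powr (1 - 1 / 2 ^ k) * real (card S) powr (1 / 2 ^ k)"
  have fin: "finite (last_arcs w A k v S)" for v
    using finite_V by (intro finite_subset[OF last_arcs_subset] finite_subset[OF arcs_subset]) simp
  have "card (preserver_arcs k S) \<le> card (\<Union>v\<in>V. last_arcs w A k v S)"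
    using fin finite_V by (intro card_mono preserver_arcs_last) auto
  also have "\<dots> \<le> (\<Sum>v\<in>V. card (last_arcs w A k v S))" by (intro card_UN_le finite_V)
  finally have "real (card (preserver_arcs k S)) \<le> (\<Sum>v\<in>V. real (card (last_arcs w A k v S)))"
    by (simp only: of_nat_le_iff of_nat_sum[symmetric])
  also have "\<dots> \<le> (\<Sum>v\<in>V. c)"
    unfolding c_def using card_last_arcs[OF unique_walks_axioms assms] by (intro sum_mono) auto
  also have "\<dots> = real (card V) * c" by simp
  also have "\<dots> = arcs_const k * (real (card V) powr 1 * real (card V) powr (1 - 1 / 2 ^ k)) *
      real (card S) powr (1 / 2 ^ k)"
    by (simp add: c_def)
  also have "real (card V) powr 1 * real (card V) powr (1 - 1 / 2 ^ k) = real (card V) powr (2 - 1 / 2 ^ k)"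
    by (subst powr_add[symmetric]) simp
  finally show ?thesis .
qed

text \<open>If all \<open>k + 1\<close> faults occur, one is put back and \<open>restoration\<close>
  is applied to the other \<open>k\<close>. Both halves start in \<open>S\<close> and so lie in the
  union; the second is traversed backwards, which is why the converse arcs are added.\<close>

lemma walk_in_preserver:
  assumes S: "s \<in> S" "t \<in> S" and F: "finite F" "card F \<le> Suc k"
    and edges: "\<And>e. e \<in> F \<Longrightarrow> \<exists>c d. e = {c, d}" and P: "walk (avoid A F) s P t"
  shows "\<exists>Q. walk (avoid (preserver_arcs k S \<union> (preserver_arcs k S)\<inverse>) F) s Q t \<and> length Q \<le> length P"
proof -
  let ?H = "preserver_arcs k S"
  have in_H: "set p \<subseteq> ?H" if "x \<in> S" "finite F'" "card F' \<le> k" "sp w (avoid A F') x p v" for x F' p v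
    unfolding preserver_arcs_def using that by blast
  show ?thesis
  proof (cases "card F \<le> k")
    case True
    have Q: "sp w (avoid A F) s (path F s t) t" by (rule sp_avoid_exists[OF P])
    have "set (path F s t) \<subseteq> avoid (?H \<union> ?H\<inverse>) F"
      using in_H[OF S(1) F(1) True Q] walk_set[OF sp_walk[OF Q]] by (auto simp: avoid_def)
    then have "walk (avoid (?H \<union> ?H\<inverse>) F) s (path F s t) t" by (rule walk_restrict[OF sp_walk[OF Q]])
    then show ?thesis using sp_length_le[OF avoid_subset Q P] by blast
  next
    case False
    then obtain e where "e \<in> F" by fastforce
    then obtain c d where e: "{c, d} \<in> F" using edges by blast
    define F' where "F' = F - {{c, d}}"
    have F': "finite F'" "card F' \<le> k" using F e by (auto simp: F'_def)
    have av: "avoid A F' - {(c, d), (d, c)} = avoid A F"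
      using e by (auto simp: avoid_def F'_def doubleton_eq_iff insert_commute)
    from restoration[OF avoid_subset sym_avoid[OF sym_arcs], of F' c d, unfolded av, OF P]
    obtain x p q where pq: "sp w (avoid A F') s p x" "sp w (avoid A F') t q x"
      "set p \<subseteq> avoid A F" "set q \<subseteq> avoid A F" "length p + length q \<le> length P" by blast
    let ?B = "avoid (?H \<union> ?H\<inverse>) F"
    have "set p \<subseteq> ?B" "set q \<subseteq> ?B"
      using in_H[OF S(1) F' pq(1)] in_H[OF S(2) F' pq(2)] pq(3,4) by (auto simp: avoid_def)
    then have "walk ?B s p x" "walk ?B t q x"
      using walk_restrict[OF sp_walk[OF pq(1)]] walk_restrict[OF sp_walk[OF pq(2)]] by simp_all
    moreover have "sym ?B" by (intro sym_avoid) (auto simp: sym_def)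
    ultimately have "walk ?B s p x" "walk ?B x (rev (map prod.swap q)) t"
      using walk_rev[of ?B t q x] by simp_all
    then have "walk ?B s (p @ rev (map prod.swap q)) t" by (auto simp: walk_append)
    then show ?thesis using pq(5) by (intro exI[of _ "p @ rev (map prod.swap q)"]) simp
  qed
qed

end

theorem theorem26:
  fixes f :: nat
  shows "\<exists>C::real. \<forall>(G :: 'a pair_pre_digraph) S.
    pair_graph G \<and> S \<subseteq> pverts G \<longrightarrow>
    (\<exists>H. ft_dist_preserver (f + 1) S S G H \<and>
         real (card (uedges H))
           \<le> C * real (card (pverts G)) powr (2 - 1 / 2 ^ f)
               * real (card S) powr (1 / 2 ^ f))"
proof (intro exI[of _ "arcs_const f"] allI impI, elim conjE)
  fix G :: "'a pair_pre_digraph" and S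
  assume G: "pair_graph G" and S: "S \<subseteq> pverts G"
  interpret G: pair_graph G by fact
  have "parcs G \<subseteq> pverts G \<times> pverts G"
    using G.arc_fst_in_verts G.arc_snd_in_verts by fastforce
  moreover have symG: "sym (parcs G)" using G.sym_arcs by (simp add: symmetric_def)
  moreover have "(v, v) \<notin> parcs G" for v using G.pair_no_loops by fastforce
  ultimately obtain w M where "unique_walks (pverts G) (parcs G) w M"
    using ex_unique_walks G.pair_finite_verts by blast
  then interpret unique_walks "pverts G" "parcs G" w M .
  define X where "X = preserver_arcs f S"
  define H where "H = \<lparr> pverts = pverts G, parcs = X \<union> X\<inverse> \<rparr>"
  have pH: "pverts H = pverts G" "parcs H = X \<union> X\<inverse>" by (simp_all add: H_def)
  have XG: "X \<union> X\<inverse> \<subseteq> parcs G"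
    using preserver_arcs_subset[of f S] symG by (auto simp: X_def sym_def)
  have "arcs_ends (with_proj H) = X \<union> X\<inverse>"
    by (auto simp: arcs_ends_conv pH)
  then have "symmetric (with_proj H)"
    by (auto simp: symmetric_def sym_def)
  moreover have "fst e \<in> pverts G" "snd e \<in> pverts G" "fst e \<noteq> snd e" if "e \<in> X \<union> X\<inverse>" for e
    using that XG G.arc_fst_in_verts G.arc_snd_in_verts G.pair_no_loops by blast+
  ultimately have H: "pair_graph H"
    using G.pair_finite_verts finite_subset[OF XG G.pair_finite_arcs]
    by unfold_locales (simp_all add: pH)
  have "ft_dist_preserver (f + 1) S S G H"
  proof (rule ft_dist_preserverI[OF G H pH(1) _ S])
    show "parcs H \<subseteq> parcs G" using XG pH by simp
    fix s t F P
    assume *: "s \<in> S" "t \<in> S" "F \<subseteq> uedges G" "card F \<le> f + 1" "walk (avoid (parcs G) F) s P t"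
    have "\<exists>c d. e = {c, d}" if "e \<in> F" for e
      using subsetD[OF *(3) that] unfolding uedges_def by blast
    then show "\<exists>Q. walk (avoid (parcs H) F) s Q t \<and> length Q \<le> length P"
      using walk_in_preserver[OF *(1,2) finite_subset[OF *(3) finite_uedges[OF G]] _ _ *(5), of f] *(4)
      unfolding pH X_def by simp
  qed
  moreover have "card (uedges H) \<le> card X"
  proof -
    \<comment> \<open>Adding the converse arcs creates no new undirected edges.\<close>
    have "uedges H = (\<lambda>(u, v). {u, v}) ` X"
      by (auto simp: uedges_def pH image_def insert_commute)
    then show ?thesis
      using card_image_le finite_subset[OF _ G.pair_finite_arcs, of X] XG by auto
  qed
  ultimately show "\<exists>H. ft_dist_preserver (f + 1) S S G H \<and>
      real (card (uedges H))
        \<le> arcs_const f * real (card (pverts G)) powr (2 - 1 / 2 ^ f) * real (card S) powr (1 / 2 ^ f)"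
    using card_preserver_arcs[OF S, of f] unfolding X_def[symmetric]
    by (intro exI[of _ H]) linarith
qed

end
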